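(* Let $a\in\mathbb{R}$ and $p\in\mathbb{R}$ with $0<p<1$, and let $\mathfrak{S}=\{x\in\mathbb{C}: -1\le \operatorname{Im}(x)\le 0\}$. Let $F(z)$, with $z=a\,x(x+i)$, be analytic for $x\in\mathfrak{S}$ and diverge less quickly than $e^{\pi|x|}/x$ as $\operatorname{Re}(x)\to\pm\infty$. Then $$\int_{-\infty}^{\infty}\frac{F(a\,x(x+i))}{\sinh(\pi p(2x+i))}\,dx=-\frac{i\,F(a/4)}{2p}.$$ For $p=1/2$ this reduces to $$\int_{-\infty}^{\infty}\frac{F(a\,x(x+i))}{\cosh(\pi x)}\,dx=F(a/4).$$
   Context: Here $F$ is a complex function of $z=a\,x(x+i)$, where $x$ is a complex variable, and $\mathfrak{S}$ is the closed horizontal strip between the lines $\operatorname{Im}(x)=-1$ and $\operatorname{Im}(x)=0$.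
   Formalization: For p<1/2 the integral can diverge, so the formula is proved if the integral exists, or as a limit over [-R,R] if F=o(e^{2πp|x|}/x). For p=1/2 and the cosh formula it is a limit over [-R,R], and the full integral whenever that exists. *)

theory Defs
  imports "HOL-Complex_Analysis.Complex_Analysis" "HOL-Library.Landau_Symbols"
begin

definition strip :: "complex set" where
  "strip = {x. - 1 \<le> Im x \<and> Im x \<le> 0}"

definition zmap :: "real \<Rightarrow> complex \<Rightarrow> complex" where
  "zmap a x = of_real a * x * (x + \<i>)"

text \<open>\<open>x\<close> stays in the strip while \<open>Re x\<close> tends to plus or minus infinity; statements along this
  filter are therefore uniform in \<open>Im x\<close>.\<close>

definition strip_ends :: "complex filter" where
  "strip_ends = inf (principal strip) (filtercomap (\<lambda>x. \<bar>Re x\<bar>) at_top)"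

text \<open>With \<open>c = 1\<close> this reads: \<open>F\<close> diverges less quickly than \<open>e\<^sup>\<pi>\<^sup>|\<^sup>x\<^sup>| / x\<close>.\<close>

definition subexp_growth :: "real \<Rightarrow> real \<Rightarrow> (complex \<Rightarrow> complex) \<Rightarrow> bool" where
  "subexp_growth c a F \<longleftrightarrow>
     (\<lambda>x. F (zmap a x)) \<in> o[strip_ends](\<lambda>x. of_real (exp (c * pi * norm x)) / x)"

text \<open>The integral over the real line as the limit of the integrals over \<open>[-R, R]\<close>. At \<open>p = 1/2\<close>
  the growth condition only makes the integrand \<open>o(1/x)\<close>, and then neither absolute convergence
  nor convergence at the two ends separately is guaranteed. Example: with \<open>u = x + i/2\<close> and
  \<open>F = sinh (\<pi> u) / (u ln (u\<^sup>2 + 4))\<close>, an even function of \<open>u\<close>, the integrand is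
  \<open>1 / (u ln (u\<^sup>2 + 4))\<close> up to a constant factor.\<close>

definition has_line_integral :: "(real \<Rightarrow> complex) \<Rightarrow> complex \<Rightarrow> bool" where
  "has_line_integral f v \<longleftrightarrow>
     (\<forall>R. f integrable_on {- R..R}) \<and> ((\<lambda>R. integral {- R..R} f) \<longlongrightarrow> v) at_top"

definition sinh_integrand :: "(complex \<Rightarrow> complex) \<Rightarrow> real \<Rightarrow> real \<Rightarrow> real \<Rightarrow> complex" where
  "sinh_integrand F a p x =
     F (zmap a (of_real x)) / sinh (of_real (pi * p) * (2 * of_real x + \<i>))"

definition cosh_integrand :: "(complex \<Rightarrow> complex) \<Rightarrow> real \<Rightarrow> real \<Rightarrow> complex" where
  "cosh_integrand F a x = F (zmap a (of_real x)) / cosh (of_real pi * of_real x)"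

text \<open>For \<open>p < 1/2\<close> the growth condition with \<open>c = 1\<close> does not force the integral against
  \<open>1 / sinh (\<pi> p (2 x + i))\<close> to converge: take \<open>p = 1/4\<close> and \<open>F = cosh (9/10 \<pi> (x + i/2))\<close>, which is
  an entire function of \<open>z\<close> when \<open>a \<noteq> 0\<close>. The growth that fits the denominator is \<open>c = 2 p\<close>. The
  symmetric limit alone is no substitute for convergence: with \<open>u = x + i/2\<close>,
  \<open>F = sinh (2 \<pi> p u) tanh u\<close> satisfies the condition with \<open>c = 1\<close> and has a convergent, but wrong,
  symmetric limit.\<close>

end

theory Submission
  imports Defs "HOL-Real_Asymp.Real_Asymp"
begin

text \<open>Put \<open>h x = F (zmap a x) / sinh (\<pi> p (2 x + \<i>))\<close>. The map \<open>x \<mapsto> - \<i> - x\<close>, the half-turn about the centre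
  \<open>- \<i> / 2\<close> of the strip, fixes \<open>zmap a x = a x (x + \<i>)\<close> and changes the sign of the hyperbolic sine, so
  \<open>h\<close> is odd under it. As \<open>p < 1\<close>, the only pole of \<open>h\<close> in the strip is the simple pole at \<open>- \<i> / 2\<close>,
  with residue \<open>F (a / 4) / (2 \<pi> p)\<close>. By oddness, opposite sides of the rectangle between \<open>- R - \<i>\<close> and
  \<open>R\<close> contribute equally to the contour integral; the residue theorem gives the integral of \<open>h\<close> over
  \<open>[- R, R]\<close> as \<open>- \<i> F (a / 4) / (2 p)\<close> up to the integral over one vertical side
  (\<open>strip_integral_residue\<close>, \<open>strip_sinh_integral\<close>).

  If \<open>F\<close> grows at the rate \<open>c \<le> 2 p\<close>, then \<open>h\<close> is \<open>o(1 / x)\<close> at the ends of the strip, the vertical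
  side disappears in the limit, and the symmetric integral has the asserted value
  (\<open>sinh_integrand_line_integral\<close>). For \<open>p > 1 / 2\<close> the decay is even exponential
  (\<open>sinh_integrand_absolutely_integrable\<close>).

  If \<open>p < 1 / 2\<close> and only the rate \<open>c = 1\<close> is known, then the growth condition does not bound the
  vertical side, and convergence of the integral over the real line must be used. The factor \<open>exp (- \<epsilon> x (x + \<i>))\<close> respects the
  symmetry and decays like a Gaussian, so the weighted integral is known exactly for every \<open>\<epsilon> > 0\<close>
  (\<open>sinh_integral_gaussian_weight\<close>). Letting \<open>\<epsilon>\<close> tend to zero, an Abelian theorem identifies the
  limit with the integral of \<open>h\<close> (\<open>gaussian_abel_summation\<close>); this plays the part of a
  Phragmen-Lindelof argument.

  At \<open>p = 1 / 2\<close> the denominator is \<open>\<i> cosh (\<pi> x)\<close>, which yields the second formula.\<close>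

section \<open>Residues for integrands that are odd about \<open>- \<i> / 2\<close>\<close>

lemma contour_integral_linepath_point_reflection:
  fixes h :: "complex \<Rightarrow> complex"
  assumes "\<And>x. x \<in> closed_segment a b \<Longrightarrow> h (c - x) = - h x"
  shows "contour_integral (linepath (c - a) (c - b)) h = contour_integral (linepath a b) h"
proof -
  have "h (linepath (c - a) (c - b) t) * (c - b - (c - a)) = h (linepath a b t) * (b - a)"
    if "t \<in> {0..1}" for t
  proof -
    have "linepath (c - a) (c - b) t = c - linepath a b t"
      by (simp add: linepath_def scaleR_conv_of_real algebra_simps)
    moreover have "h (c - linepath a b t) = - h (linepath a b t)"
      using assms that linepath_in_path by blast
    ultimately show ?thesis
      by (simp only:) (simp add: algebra_simps)
  qed
  then show ?thesis
    unfolding contour_integral_integral by (intro Henstock_Kurzweil_Integration.integral_cong) simp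
qed

text \<open>The point reflection \<open>x \<mapsto> - \<i> - x\<close> exchanges opposite sides of the rectangle with corners
  \<open>- R - \<i>\<close> and \<open>R\<close>. For a function that is odd under it the integrals over opposite sides agree, so
  half of the residue theorem reads: minus the integral over \<open>[- R, R]\<close>, plus the integral over the
  right side, is \<open>\<pi> \<i>\<close> times the residue. The right side has length one, hence the error bound \<open>B\<close>.\<close>

lemma strip_integral_residue:
  fixes h :: "complex \<Rightarrow> complex"
  assumes S: "open S" "strip \<subseteq> S" and holo: "h holomorphic_on S - {- \<i> / 2}"
    and odd: "\<And>x. x \<in> strip \<Longrightarrow> h (- \<i> - x) = - h x"
    and R: "0 < R" and B: "\<And>x. x \<in> strip \<Longrightarrow> Re x = R \<Longrightarrow> norm (h x) \<le> B"
  shows "norm (integral {- R..R} (\<lambda>t. h (of_real t)) + of_real pi * \<i> * residue h (- \<i> / 2)) \<le> B"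
proof -
  define c where "c = - \<i> / 2"
  \<comment> \<open>The residue theorem wants a connected domain. The strip is convex, so a single component of \<open>S\<close>
     contains all of it.\<close>
  define T where "T = connected_component_set S c"
  have "strip = {x. Im x \<ge> - 1} \<inter> {x. Im x \<le> 0}"
    by (auto simp: strip_def)
  then have "convex strip"
    by (metis convex_Int convex_halfspace_Im_ge convex_halfspace_Im_le)
  moreover have c: "c \<in> strip" by (simp add: c_def strip_def)
  ultimately have strip_T: "strip \<subseteq> T"
    unfolding T_def using S(2) by (intro connected_component_maximal convex_connected)
  have T: "open T" "connected T" "T \<subseteq> S"
    unfolding T_def using S by (auto simp: open_connected_component connected_component_subset)
  define a1 a2 a3 a4 where "a1 = Complex (- R) (- 1)" "a2 = Complex R (- 1)"
    "a3 = Complex R 0" "a4 = Complex (- R) 0"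
  note a_defs = this
  have box: "cbox a1 a3 \<subseteq> strip"
    by (auto simp: a_defs strip_def in_cbox_complex_iff)
  have c_box: "c \<in> box a1 a3"
    using R by (simp add: a_defs c_def in_box_complex_iff)
  have path: "path_image (rectpath a1 a3) = cbox a1 a3 - box a1 a3"
    using R by (intro path_image_rectpath_cbox_minus_box) (auto simp: a_defs)
  have path_sub: "path_image (rectpath a1 a3) \<subseteq> T - {c}"
    using path c_box box strip_T by auto
  have holo_T: "h holomorphic_on T - {c}"
    using T(3) unfolding c_def by (intro holomorphic_on_subset[OF holo]) auto
  have "contour_integral (rectpath a1 a3) h
      = 2 * pi * \<i> * (\<Sum>p\<in>{c}. winding_number (rectpath a1 a3) p * residue h p)"
  proof (rule Residue_theorem[OF T(1,2)])
    show "\<forall>z. z \<notin> T \<longrightarrow> winding_number (rectpath a1 a3) z = 0"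
      using R box strip_T by (auto intro!: winding_number_rectpath_outside simp: a_defs)
  qed (use holo_T path_sub in auto)
  then have res: "contour_integral (rectpath a1 a3) h = 2 * (of_real pi * \<i> * residue h c)"
    using winding_number_rectpath[OF c_box] by simp
  have cont: "continuous_on (T - {c}) h"
    using holo_T holomorphic_on_imp_continuous_on by blast
  have rect: "rectpath a1 a3 = linepath a1 a2 +++ linepath a2 a3 +++ linepath a3 a4 +++ linepath a4 a1"
    by (simp add: rectpath_def Let_def a_defs)
  have segs: "closed_segment a1 a2 \<union> closed_segment a2 a3 \<union> closed_segment a3 a4 \<union> closed_segment a4 a1 \<subseteq> T - {c}"
    using path_sub unfolding rect by (simp add: path_image_join Un_assoc)
  have ints: "h contour_integrable_on linepath a1 a2" "h contour_integrable_on linepath a2 a3"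
     "h contour_integrable_on linepath a3 a4" "h contour_integrable_on linepath a4 a1"
    using segs by (auto intro!: contour_integrable_continuous_linepath continuous_on_subset[OF cont])
  have sum: "contour_integral (rectpath a1 a3) h = contour_integral (linepath a1 a2) h
     + (contour_integral (linepath a2 a3) h + (contour_integral (linepath a3 a4) h + contour_integral (linepath a4 a1) h))"
    unfolding rect using ints by (simp add: valid_path_join contour_integrable_joinI)
  have seg_strip: "x \<in> strip" if "x \<in> closed_segment a2 a3 \<union> closed_segment a3 a4" for x
    using that box path unfolding rect by (auto simp: path_image_join)
  have refl: "a1 = - \<i> - a3" "a2 = - \<i> - a4" "a4 = - \<i> - a2"
    by (simp_all add: a_defs complex_eq_iff)
  have "contour_integral (linepath a1 a2) h = contour_integral (linepath a3 a4) h"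
    unfolding refl(1,2) by (rule contour_integral_linepath_point_reflection) (use odd seg_strip in auto)
  moreover have "contour_integral (linepath a4 a1) h = contour_integral (linepath a2 a3) h"
    unfolding refl(1,3) by (rule contour_integral_linepath_point_reflection) (use odd seg_strip in auto)
  moreover have "contour_integral (linepath a3 a4) h = - contour_integral (linepath a4 a3) h"
    using segs by (intro contour_integral_reverse_linepath continuous_on_subset[OF cont])
      (auto simp: closed_segment_commute)
  moreover have "contour_integral (linepath a4 a3) h = integral {- R..R} (\<lambda>t. h (of_real t))"
    using R by (subst contour_integral_linepath_Reals_eq) (auto simp: a_defs complex_is_Real_iff)
  ultimately have "2 * (of_real pi * \<i> * residue h c)
      = 2 * (contour_integral (linepath a2 a3) h - integral {- R..R} (\<lambda>t. h (of_real t)))"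
    using res sum by simp
  then have "integral {- R..R} (\<lambda>t. h (of_real t)) + of_real pi * \<i> * residue h c
      = contour_integral (linepath a2 a3) h"
    by (simp only: mult_cancel_left) simp
  moreover have "norm (contour_integral (linepath a2 a3) h) \<le> B * norm (a3 - a2)"
  proof (rule contour_integral_bound_linepath[OF ints(2)])
    show "0 \<le> B"
      using B[of a3] norm_ge_zero[of "h a3"] by (simp add: a_defs strip_def del: norm_ge_zero)
    fix x assume x: "x \<in> closed_segment a2 a3"
    then have "Re x = R" by (auto simp: a_defs closed_segment_same_Re)
    then show "norm (h x) \<le> B" using B seg_strip x by auto
  qed
  moreover have "norm (a3 - a2) = 1"
    by (simp add: a_defs cmod_def)
  ultimately show ?thesis by (simp add: c_def)
qed

section \<open>The kernel \<open>1 / sinh (\<pi> p (2 x + \<i>))\<close>\<close>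

text \<open>The zeros of the denominator are \<open>- \<i> / 2\<close> plus the integer multiples of \<open>\<i> / (2 p)\<close>, so exactly
  one of them lies in the open strip of half-width \<open>1 / (2 p)\<close> about the line \<open>Im x = - 1 / 2\<close>. For
  \<open>p < 1\<close> this open strip contains the closed strip of integration.\<close>

lemma sinh_kernel_zero_iff:
  fixes x :: complex
  assumes "0 < p" "\<bar>Im x + 1 / 2\<bar> < 1 / (2 * p)"
  shows "sinh (of_real (pi * p) * (2 * x + \<i>)) = 0 \<longleftrightarrow> x = - \<i> / 2"
proof
  assume "sinh (of_real (pi * p) * (2 * x + \<i>)) = 0"
  then obtain n :: int where "\<i> * (of_real (pi * p) * (2 * x + \<i>)) = of_real (of_int n * pi)"
    by (auto simp: sinh_conv_sin sin_eq_0)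
  then have re: "- (pi * p * (2 * Im x + 1)) = of_int n * pi" and im: "pi * p * (2 * Re x) = 0"
    by (simp_all add: complex_eq_iff)
  have "pi * (of_int n + p * (2 * Im x + 1)) = 0"
    using re by (simp add: algebra_simps)
  then have "of_int n = - p * (2 * Im x + 1)"
    by simp
  then have "\<bar>of_int n\<bar> = \<bar>- (2 * p) * (Im x + 1 / 2)\<bar>"
    by (simp add: algebra_simps)
  also have "\<dots> = 2 * p * \<bar>Im x + 1 / 2\<bar>"
    using assms(1) by (simp add: abs_mult)
  also have "\<dots> < 1"
    using assms by (simp add: field_simps)
  finally have "n = 0" by linarith
  with re im assms(1) show "x = - \<i> / 2"
    by (simp add: complex_eq_iff)
qed auto

lemma residue_sinh_kernel:
  fixes G :: "complex \<Rightarrow> complex"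
  assumes p: "0 < p" and U: "open U" "- \<i> / 2 \<in> U"
    "(\<lambda>x. G x / sinh (of_real (pi * p) * (2 * x + \<i>))) holomorphic_on U - {- \<i> / 2}"
    and G: "isCont G (- \<i> / 2)"
  shows "residue (\<lambda>x. G x / sinh (of_real (pi * p) * (2 * x + \<i>))) (- \<i> / 2)
           = G (- \<i> / 2) / of_real (2 * pi * p)"
proof (rule residue_simple'[OF U])
  let ?k = "\<lambda>x. sinh (of_real (pi * p) * (2 * x + \<i>)) :: complex"
  have "(?k has_field_derivative of_real (2 * pi * p)) (at (- \<i> / 2))"
    by (auto intro!: derivative_eq_intros)
  then have "((\<lambda>w. ?k w / (w - (- \<i> / 2))) \<longlongrightarrow> of_real (2 * pi * p)) (at (- \<i> / 2))"
    by (simp add: has_field_derivative_iff)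
  then have "((\<lambda>w. G w / (?k w / (w - (- \<i> / 2)))) \<longlongrightarrow> G (- \<i> / 2) / of_real (2 * pi * p)) (at (- \<i> / 2))"
    using p G by (intro tendsto_divide) (auto simp: isCont_def)
  then show "((\<lambda>w. G w / ?k w * (w - - \<i> / 2)) \<longlongrightarrow> G (- \<i> / 2) / of_real (2 * pi * p)) (at (- \<i> / 2))"
    by simp
qed

text \<open>The quantitative form, at a finite \<open>R\<close> and for any function \<open>G\<close> that is even about \<open>- \<i> / 2\<close>, serves
  twice: for \<open>G x = F (zmap a x)\<close>, and for its product with a Gaussian. The product need not be a
  function of \<open>zmap a x\<close> when \<open>a = 0\<close>, so evenness is the hypothesis here.\<close>

lemma strip_sinh_integral:
  fixes G :: "complex \<Rightarrow> complex"
  assumes p: "0 < p" "p < 1" and analytic: "G analytic_on strip"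
    and sym: "\<And>x. G (- \<i> - x) = G x" and R: "0 < R"
    and B: "\<And>x. x \<in> strip \<Longrightarrow> Re x = R \<Longrightarrow> norm (G x / sinh (of_real (pi * p) * (2 * x + \<i>))) \<le> B"
  shows "norm (integral {- R..R} (\<lambda>t. G (of_real t) / sinh (of_real (pi * p) * (2 * of_real t + \<i>)))
           - - (\<i> * G (- \<i> / 2) / of_real (2 * p))) \<le> B"
proof -
  define h where "h = (\<lambda>x. G x / sinh (of_real (pi * p) * (2 * x + \<i>)))"
  obtain T where T: "open T" "strip \<subseteq> T" "G holomorphic_on T"
    using analytic unfolding analytic_on_holomorphic by blast
  define S where "S = T \<inter> {x. \<bar>Im x + 1 / 2\<bar> < 1 / (2 * p)}"
  have S: "open S"
    unfolding S_def by (intro open_Int T open_Collect_less continuous_intros)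
  have "1 < 1 / p" using p by (simp add: field_simps)
  then have "1 / 2 < 1 / (2 * p)" by simp
  then have strip_S: "strip \<subseteq> S"
    using T(2) by (auto simp: S_def strip_def)
  have c: "- \<i> / 2 \<in> strip" by (simp add: strip_def)
  have sinh_holo: "(\<lambda>x. sinh (of_real (pi * p) * (2 * x + \<i>)) :: complex) holomorphic_on A" for A
    unfolding sinh_field_def by (intro holomorphic_intros) auto
  have holo: "h holomorphic_on S - {- \<i> / 2}"
    unfolding h_def using sinh_kernel_zero_iff[OF p(1)]
    by (intro holomorphic_on_divide sinh_holo holomorphic_on_subset[OF T(3)]) (auto simp: S_def)
  have odd: "h (- \<i> - x) = - h x" for x
  proof -
    have "of_real (pi * p) * (2 * (- \<i> - x) + \<i>) = - (of_real (pi * p) * (2 * x + \<i>))"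
      by (simp add: algebra_simps)
    then show ?thesis unfolding h_def sym by (metis minus_divide_right sinh_minus)
  qed
  have "isCont G (- \<i> / 2)"
    using analytic c analytic_on_imp_differentiable_at field_differentiable_imp_continuous_at by blast
  then have res: "residue h (- \<i> / 2) = G (- \<i> / 2) / of_real (2 * pi * p)"
    unfolding h_def using S strip_S c holo p
    by (intro residue_sinh_kernel[of p S]) (auto simp: h_def)
  have "of_real pi * \<i> * residue h (- \<i> / 2) = \<i> * G (- \<i> / 2) / of_real (2 * p)"
    unfolding res using p by (simp add: field_simps)
  moreover have "norm (integral {- R..R} (\<lambda>t. h (of_real t)) + of_real pi * \<i> * residue h (- \<i> / 2)) \<le> B"
    using S strip_S holo odd R B by (intro strip_integral_residue) (auto simp: h_def)
  ultimately show ?thesis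
    by (simp add: h_def)
qed

section \<open>Growth along the ends of the strip\<close>

lemma norm_sinh_strip_ge:
  fixes x :: complex
  assumes p: "0 < p" and x: "1 \<le> 2 * pi * p * \<bar>Re x\<bar>"
  shows "exp (2 * pi * p * \<bar>Re x\<bar>) / 4 \<le> norm (sinh (of_real (pi * p) * (2 * x + \<i>)))"
proof -
  define w where "w = of_real (pi * p) * (2 * x + \<i>)"
  define u where "u = 2 * pi * p * \<bar>Re x\<bar>"
  have "Re w = 2 * pi * p * Re x" by (simp add: w_def)
  then have u: "u = \<bar>Re w\<bar>"
    using p by (simp add: u_def abs_mult)
  have "exp u - exp (- u) \<le> \<bar>norm (exp w) - norm (exp (- w))\<bar>"
    unfolding norm_exp_eq_Re u by (cases "0 \<le> Re w") auto
  also have "\<dots> \<le> norm (exp w - exp (- w))"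
    by (rule norm_triangle_ineq3)
  also have "\<dots> = 2 * norm (sinh w)"
    by (simp add: sinh_field_def norm_divide)
  finally have 1: "exp u - exp (- u) \<le> 2 * norm (sinh w)" .
  have "2 \<le> exp u"
    using exp_ge_add_one_self[of u] x unfolding u_def by linarith
  moreover from this have "exp (- u) \<le> 1 / 2"
    by (simp add: exp_minus field_simps)
  ultimately show ?thesis
    using 1 unfolding w_def[symmetric] u_def[symmetric] by linarith
qed

text \<open>On the strip \<open>norm x \<le> \<bar>Re x\<bar> + 1\<close>, so the growth of \<open>F\<close> in \<open>norm x\<close> can be measured in \<open>\<bar>Re x\<bar>\<close> at
  the price of a factor \<open>e\<^sup>c\<^sup>\<pi>\<close>. This factor and the constant of \<open>norm_sinh_strip_ge\<close> are absorbed into the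
  arbitrary \<open>\<eta>\<close>.\<close>

lemma strip_growth_bound:
  assumes growth: "subexp_growth c a F" and c: "0 \<le> c" and p: "0 < p" and \<eta>: "0 < \<eta>"
  obtains R0 where "1 \<le> R0"
    "\<And>x. x \<in> strip \<Longrightarrow> R0 \<le> \<bar>Re x\<bar> \<Longrightarrow>
       norm (F (zmap a x) / sinh (of_real (pi * p) * (2 * x + \<i>)))
         \<le> \<eta> * exp ((c - 2 * p) * pi * \<bar>Re x\<bar>) / \<bar>Re x\<bar>"
proof -
  define \<delta> where "\<delta> = \<eta> / (4 * exp (c * pi))"
  have "\<delta> > 0" using \<eta> by (simp add: \<delta>_def)
  with growth have "eventually (\<lambda>x. norm (F (zmap a x)) \<le> \<delta> * norm (of_real (exp (c * pi * norm x)) / x)) strip_ends"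
    unfolding subexp_growth_def by (rule landau_o.smallD)
  then obtain N where N: "\<And>x. x \<in> strip \<Longrightarrow> N \<le> \<bar>Re x\<bar> \<Longrightarrow>
      norm (F (zmap a x)) \<le> \<delta> * norm (of_real (exp (c * pi * norm x)) / x)"
    unfolding strip_ends_def
    by (subst (asm) inf.commute) (auto simp: eventually_inf_principal eventually_filtercomap_at_top_linorder)
  define R0 where "R0 = max 1 (max N (1 / (2 * pi * p)))"
  show thesis
  proof (rule that[of R0])
    show "1 \<le> R0" by (simp add: R0_def)
    fix x :: complex assume x: "x \<in> strip" "R0 \<le> \<bar>Re x\<bar>"
    define s where "s = \<bar>Re x\<bar>"
    have s: "1 \<le> s" "N \<le> s" "1 / (2 * pi * p) \<le> s"
      using x by (auto simp: R0_def s_def)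
    have s_le: "s \<le> norm x" by (simp add: s_def abs_Re_le_cmod)
    have "norm x \<le> s + 1"
      using cmod_le[of x] x(1) by (simp add: s_def strip_def)
    then have "c * pi * norm x \<le> c * pi * (s + 1)"
      using c by (intro mult_left_mono) auto
    then have "exp (c * pi * norm x) \<le> exp (c * pi) * exp (c * pi * s)"
      by (simp add: algebra_simps flip: exp_add)
    then have "exp (c * pi * norm x) / norm x \<le> exp (c * pi) * exp (c * pi * s) / s"
      using s s_le by (intro frac_le) auto
    then have "\<delta> * norm (of_real (exp (c * pi * norm x)) / x) \<le> \<delta> * (exp (c * pi) * exp (c * pi * s) / s)"
      using \<open>\<delta> > 0\<close> by (intro mult_left_mono) (auto simp: norm_divide)
    also have "\<dots> = \<eta> * exp (c * pi * s) / s / 4"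
      by (simp add: \<delta>_def)
    finally have num: "norm (F (zmap a x)) \<le> \<eta> * exp (c * pi * s) / s / 4"
      using N x s by (force simp: s_def)
    have "1 \<le> 2 * pi * p * s"
      using s p by (simp add: field_simps)
    then have den: "exp (2 * pi * p * s) / 4 \<le> norm (sinh (of_real (pi * p) * (2 * x + \<i>)))"
      unfolding s_def by (rule norm_sinh_strip_ge[OF p])
    have "norm (F (zmap a x)) / norm (sinh (of_real (pi * p) * (2 * x + \<i>)))
        \<le> (\<eta> * exp (c * pi * s) / s / 4) / (exp (2 * pi * p * s) / 4)"
      using num den \<eta> s by (intro frac_le) auto
    also have "\<dots> = \<eta> * (exp (c * pi * s) / exp (2 * pi * p * s)) / s"
      by simp
    also have "exp (c * pi * s) / exp (2 * pi * p * s) = exp ((c - 2 * p) * pi * s)"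
      by (simp add: algebra_simps flip: exp_diff)
    finally show "norm (F (zmap a x) / sinh (of_real (pi * p) * (2 * x + \<i>)))
         \<le> \<eta> * exp ((c - 2 * p) * pi * \<bar>Re x\<bar>) / \<bar>Re x\<bar>"
      by (simp add: norm_divide s_def)
  qed
qed

section \<open>The integral of \<open>F\<close> against the kernel\<close>

lemma zmap_reflect: "zmap a (- \<i> - x) = zmap a x"
  by (simp add: zmap_def algebra_simps)

lemma zmap_centre: "zmap a (- \<i> / 2) = of_real (a / 4)"
  by (simp add: zmap_def algebra_simps)

lemma real_in_strip: "of_real t \<in> strip"
  by (simp add: strip_def)

lemma continuous_sinh_quotient:
  assumes p: "0 < p" "p < 1" and analytic: "G analytic_on strip"
  shows "continuous_on A (\<lambda>t::real. G (of_real t) / sinh (of_real (pi * p) * (2 * of_real t + \<i>)))"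
proof (rule continuous_on_divide)
  have "continuous_on strip G"
    using analytic analytic_imp_holomorphic holomorphic_on_imp_continuous_on by blast
  then show "continuous_on A (\<lambda>t::real. G (of_real t))"
    by (rule continuous_on_compose2) (auto intro!: continuous_intros simp: real_in_strip)
  show "continuous_on A (\<lambda>t. sinh (of_real (pi * p) * (2 * of_real t + \<i>)) :: complex)"
    unfolding sinh_field_def by (intro continuous_intros) auto
  have "1 < 1 / p" using p by (simp add: field_simps)
  then show "\<forall>t\<in>A. sinh (of_real (pi * p) * (2 * of_real t + \<i>)) \<noteq> (0::complex)"
    using p by (subst sinh_kernel_zero_iff) (auto simp: complex_eq_iff)
qed

lemma sinh_integrand_line_integral:
  assumes p: "0 < p" "p < 1" and analytic: "(\<lambda>x. F (zmap a x)) analytic_on strip"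
    and growth: "subexp_growth c a F" and c: "0 \<le> c" "c \<le> 2 * p"
  shows "has_line_integral (sinh_integrand F a p) (- (\<i> * F (of_real (a / 4)) / of_real (2 * p)))"
  unfolding has_line_integral_def
proof (intro conjI allI)
  fix R :: real
  show "sinh_integrand F a p integrable_on {- R..R}"
    unfolding sinh_integrand_def
    by (intro integrable_continuous_real continuous_sinh_quotient[OF p analytic])
next
  let ?v = "- (\<i> * F (of_real (a / 4)) / of_real (2 * p))"
  show "((\<lambda>R. integral {- R..R} (sinh_integrand F a p)) \<longlongrightarrow> ?v) at_top"
  proof (rule tendstoI)
    fix e :: real assume "0 < e"
    then have e: "0 < e / 2" by simp
    obtain R0 where R0: "1 \<le> R0" and bound: "\<And>x. x \<in> strip \<Longrightarrow> R0 \<le> \<bar>Re x\<bar> \<Longrightarrow>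
       norm (F (zmap a x) / sinh (of_real (pi * p) * (2 * x + \<i>)))
         \<le> (e / 2) * exp ((c - 2 * p) * pi * \<bar>Re x\<bar>) / \<bar>Re x\<bar>"
      using strip_growth_bound[OF growth c(1) p(1) e] by metis
    have "dist (integral {- R..R} (sinh_integrand F a p)) ?v < e" if R: "R0 \<le> R" for R
    proof -
      have "norm (integral {- R..R} (\<lambda>t. F (zmap a (of_real t)) / sinh (of_real (pi * p) * (2 * of_real t + \<i>)))
           - - (\<i> * F (zmap a (- \<i> / 2)) / of_real (2 * p))) \<le> e / 2"
      proof (rule strip_sinh_integral[OF p analytic])
        fix x assume x: "x \<in> strip" "Re x = R"
        have "(e / 2) * exp ((c - 2 * p) * pi * R) \<le> (e / 2) * 1"
          using c R R0 e by (intro mult_left_mono) (auto intro!: mult_nonpos_nonneg)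
        also have "\<dots> \<le> (e / 2) * R"
          using e R R0 by (intro mult_left_mono) auto
        finally have "(e / 2) * exp ((c - 2 * p) * pi * R) / R \<le> e / 2"
          using R R0 by (simp add: pos_divide_le_eq)
        then show "norm (F (zmap a x) / sinh (of_real (pi * p) * (2 * x + \<i>))) \<le> e / 2"
          using bound[of x] x R R0 by (intro order_trans[OF bound]) auto
      qed (use R R0 in \<open>auto simp: zmap_reflect\<close>)
      then show ?thesis
        using \<open>0 < e\<close> unfolding zmap_centre sinh_integrand_def dist_norm by linarith
    qed
    then show "eventually (\<lambda>R. dist (integral {- R..R} (sinh_integrand F a p)) ?v < e) at_top"
      by (rule eventually_at_top_linorderI)
  qed
qed

lemma sinh_integrand_absolutely_integrable:
  assumes p: "1 / 2 < p" "p < 1" and analytic: "(\<lambda>x. F (zmap a x)) analytic_on strip"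
    and growth: "subexp_growth 1 a F"
  shows "sinh_integrand F a p absolutely_integrable_on UNIV"
proof -
  have p0: "0 < p" using p by simp
  let ?f = "sinh_integrand F a p"
  define b where "b = (2 * p - 1) * pi"
  have b: "0 < b" using p by (simp add: b_def)
  obtain R0 where R0: "1 \<le> R0" and "\<And>x. x \<in> strip \<Longrightarrow> R0 \<le> \<bar>Re x\<bar> \<Longrightarrow>
     norm (F (zmap a x) / sinh (of_real (pi * p) * (2 * x + \<i>)))
       \<le> 1 * exp ((1 - 2 * p) * pi * \<bar>Re x\<bar>) / \<bar>Re x\<bar>"
    using strip_growth_bound[OF growth _ p0, of 1] by (metis zero_le_one zero_less_one)
  from this(2)[OF real_in_strip] have "norm (?f t) \<le> exp (- b * \<bar>t\<bar>) / \<bar>t\<bar>" if "R0 \<le> \<bar>t\<bar>" for t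
    using that unfolding sinh_integrand_def b_def
    by (simp add: minus_mult_left del: mult_minus_left)
  moreover have "exp (- b * \<bar>t\<bar>) / \<bar>t\<bar> \<le> exp (- b * \<bar>t\<bar>)" if "R0 \<le> \<bar>t\<bar>" for t
    using that R0 by (simp add: field_simps)
  ultimately have bound: "norm (?f t) \<le> exp (- b * \<bar>t\<bar>)" if "R0 \<le> \<bar>t\<bar>" for t
    using that order_trans by blast
  have cont: "continuous_on A ?f" for A
    unfolding sinh_integrand_def by (intro continuous_sinh_quotient[OF p0 p(2) analytic])
  have majorized: "?f absolutely_integrable_on A"
    if "(\<lambda>t. exp (- b * \<bar>t\<bar>)) integrable_on A" "\<And>t. t \<in> A \<Longrightarrow> R0 \<le> \<bar>t\<bar>" "A \<in> sets lebesgue" for A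
    using that bound by (intro measurable_bounded_by_integrable_imp_absolutely_integrable[of ?f A]
        continuous_imp_measurable_on_sets_lebesgue cont) auto
  \<comment> \<open>The left half-line is reached by reflecting the real majorant rather than the integrand.\<close>
  have exp_right: "(\<lambda>t. exp (- b * \<bar>t\<bar>)) integrable_on {R0..}"
    by (rule integrable_eq[OF integrable_on_exp_minus_to_infinity[OF b]]) (use R0 in auto)
  then have "(\<lambda>t. exp (- b * \<bar>- t\<bar>)) absolutely_integrable_on {R0..}"
    by (intro nonnegative_absolutely_integrable_1) auto
  then have "(\<lambda>t. exp (- b * \<bar>t\<bar>)) absolutely_integrable_on {..- R0}"
    using has_absolute_integral_reflect_real[of "{R0..}" "{..- R0}" "\<lambda>t. exp (- b * \<bar>t\<bar>)"] by auto
  then have left: "?f absolutely_integrable_on {..- R0}"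
    using R0 by (intro majorized set_lebesgue_integral_eq_integral(1)) auto
  have right: "?f absolutely_integrable_on {R0..}"
    by (intro majorized exp_right) auto
  have mid: "?f absolutely_integrable_on {- R0..R0}"
    by (intro absolutely_integrable_continuous_real cont)
  have "({..- R0} \<union> {- R0..R0}) \<union> {R0..} = UNIV"
    using R0 by auto
  then show ?thesis
    using absolutely_integrable_Un[OF absolutely_integrable_Un[OF left mid] right] by simp
qed

section \<open>Recovering the value by Gaussian summation\<close>

lemma tendsto_exp_affine_minus_square: "0 < \<epsilon> \<Longrightarrow> ((\<lambda>R::real. exp (b * R - \<epsilon> * R\<^sup>2)) \<longlongrightarrow> 0) at_top"
  by real_asymp

text \<open>Since \<open>x (x + \<i>)\<close> is invariant under \<open>x \<mapsto> - \<i> - x\<close>, so is the weight \<open>e\<close> to the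
  \<open>- \<epsilon> x (x + \<i>)\<close>, and the residue argument applies to the weighted integrand unchanged. The
  modulus of the weight on the strip is at most \<open>e\<close> to the \<open>- \<epsilon> (Re x)\<^sup>2\<close>, which defeats exponential
  growth of any rate; thus \<open>c\<close> and \<open>p\<close> are unrelated here. At the centre \<open>- \<i> / 2\<close> the weight is
  \<open>e\<close> to the \<open>- \<epsilon> / 4\<close>.\<close>

lemma sinh_integral_gaussian_weight:
  assumes p: "0 < p" "p < 1" and analytic: "(\<lambda>x. F (zmap a x)) analytic_on strip"
    and growth: "subexp_growth c a F" and c: "0 \<le> c" and eps: "0 < \<epsilon>"
  shows "((\<lambda>R. integral {- R..R} (\<lambda>t. sinh_integrand F a p t * exp (- of_real \<epsilon> * (of_real t * (of_real t + \<i>)))))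
     \<longlongrightarrow> - (\<i> * F (of_real (a / 4)) / of_real (2 * p)) * exp (- of_real \<epsilon> / 4)) at_top"
proof -
  define \<phi> where "\<phi> = (\<lambda>x::complex. exp (- of_real \<epsilon> * (x * (x + \<i>))))"
  obtain R0 where R0: "1 \<le> R0" and bound: "\<And>x. x \<in> strip \<Longrightarrow> R0 \<le> \<bar>Re x\<bar> \<Longrightarrow>
     norm (F (zmap a x) / sinh (of_real (pi * p) * (2 * x + \<i>)))
       \<le> 1 * exp ((c - 2 * p) * pi * \<bar>Re x\<bar>) / \<bar>Re x\<bar>"
    using strip_growth_bound[OF growth c p(1), of 1] by (metis zero_less_one)
  have norm_\<phi>: "norm (\<phi> x) \<le> exp (- \<epsilon> * (Re x)\<^sup>2)" if "x \<in> strip" for x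
  proof -
    \<comment> \<open>\<open>Re (x (x + \<i>)) = (Re x)\<^sup>2 - Im x (Im x + 1)\<close>, and the subtracted term is nonpositive precisely
       on the strip.\<close>
    have "Im x * (Im x + 1) \<le> 0"
      using that by (intro mult_nonpos_nonneg) (auto simp: strip_def)
    then have "(Re x)\<^sup>2 \<le> Re (x * (x + \<i>))"
      by (simp add: power2_eq_square algebra_simps)
    moreover have "Re (- of_real \<epsilon> * y) = - \<epsilon> * Re y" for y
      by simp
    ultimately show ?thesis
      using eps unfolding \<phi>_def norm_exp_eq_Re by simp
  qed
  have "\<phi> analytic_on strip"
    unfolding \<phi>_def by (intro analytic_intros)
  then have an: "(\<lambda>x. F (zmap a x) * \<phi> x) analytic_on strip"
    by (intro analytic_intros analytic)
  let ?B = "\<lambda>R. exp ((c - 2 * p) * pi * R - \<epsilon> * R\<^sup>2)"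
  have "norm (integral {- R..R} (\<lambda>t. F (zmap a (of_real t)) * \<phi> (of_real t) / sinh (of_real (pi * p) * (2 * of_real t + \<i>)))
           - - (\<i> * (F (zmap a (- \<i> / 2)) * \<phi> (- \<i> / 2)) / of_real (2 * p))) \<le> ?B R" if R: "R0 \<le> R" for R
  proof (rule strip_sinh_integral[OF p an])
    fix x :: complex
    have "(- \<i> - x) * (- \<i> - x + \<i>) = x * (x + \<i>)"
      by (simp add: algebra_simps)
    then show "F (zmap a (- \<i> - x)) * \<phi> (- \<i> - x) = F (zmap a x) * \<phi> x"
      by (simp add: zmap_reflect \<phi>_def)
  next
    fix x :: complex assume x: "x \<in> strip" "Re x = R"
    let ?k = "sinh (of_real (pi * p) * (2 * x + \<i>)) :: complex"
    have "norm (F (zmap a x) / ?k) \<le> exp ((c - 2 * p) * pi * R) / R"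
      using bound[OF x(1)] x R R0 by auto
    also have "\<dots> \<le> exp ((c - 2 * p) * pi * R)"
      using R R0 by (simp add: field_simps)
    finally have "norm (F (zmap a x) / ?k) * norm (\<phi> x) \<le> exp ((c - 2 * p) * pi * R) * exp (- \<epsilon> * R\<^sup>2)"
      using norm_\<phi>[OF x(1)] x(2) by (intro mult_mono) auto
    then show "norm (F (zmap a x) * \<phi> x / ?k) \<le> ?B R"
      by (simp add: norm_mult norm_divide flip: exp_add)
  qed (use R R0 in auto)
  moreover have "\<phi> (- \<i> / 2) = exp (- of_real \<epsilon> / 4)"
    by (simp add: \<phi>_def)
  ultimately have "norm (integral {- R..R} (\<lambda>t. sinh_integrand F a p t * \<phi> (of_real t))
           - - (\<i> * F (of_real (a / 4)) / of_real (2 * p)) * exp (- of_real \<epsilon> / 4)) \<le> ?B R" if "R0 \<le> R" for R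
    using that by (simp only: zmap_centre sinh_integrand_def) (simp add: mult_ac)
  then have "((\<lambda>R. integral {- R..R} (\<lambda>t. sinh_integrand F a p t * \<phi> (of_real t))
           - - (\<i> * F (of_real (a / 4)) / of_real (2 * p)) * exp (- of_real \<epsilon> / 4)) \<longlongrightarrow> 0) at_top"
    by (intro Lim_null_comparison[OF eventually_at_top_linorderI tendsto_exp_affine_minus_square[OF eps]])
  then show ?thesis
    unfolding \<phi>_def by (rule LIM_zero_cancel)
qed

text \<open>Dirichlet's test, uniformly in \<open>\<epsilon>\<close>: after integration by parts the primitive of \<open>f\<close> is at most
  \<open>\<eta>\<close>, and the total variation of the weight on \<open>[1, \<infinity>)\<close> is at most \<open>3 / 2\<close> whatever \<open>\<epsilon>\<close> is. The
  parameter \<open>s\<close> takes the values \<open>1\<close> and \<open>- 1\<close>, for the tails at \<open>\<infinity>\<close> and, after reflection, at \<open>- \<infinity>\<close>.\<close>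

lemma gaussian_abel_tail:
  fixes f :: "real \<Rightarrow> complex" and s \<epsilon> \<eta> M R :: real
  assumes cont: "continuous_on {M..R} f"
    and tail: "\<And>x. x \<in> {M..R} \<Longrightarrow> norm (integral {M..x} f) \<le> \<eta>"
    and M: "1 \<le> M" "M \<le> R" and eps: "0 < \<epsilon>" and s: "\<bar>s\<bar> \<le> 1"
  shows "norm (integral {M..R} (\<lambda>x. f x * exp (- of_real \<epsilon> * (of_real x * (of_real x + of_real s * \<i>)))))
           \<le> 3 * \<eta>"
proof -
  define w where "w = (\<lambda>x::real. exp (- of_real \<epsilon> * (of_real x * (of_real x + of_real s * \<i>))) :: complex)"
  define w' where "w' = (\<lambda>x::real. - of_real \<epsilon> * (2 * of_real x + of_real s * \<i>) * w x)"
  define \<Phi> where "\<Phi> = (\<lambda>x. integral {M..x} f)"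
  have \<eta>: "0 \<le> \<eta>"
    using tail[of M] M by auto
  have norm_w: "norm (w x) = exp (- \<epsilon> * x\<^sup>2)" for x
    by (simp add: w_def norm_exp_eq_Re power2_eq_square)
  have w_deriv: "(w has_vector_derivative w' x) (at x within A)" for x A
    unfolding w_def w'_def
    by (auto intro!: derivative_eq_intros has_vector_derivative_real_field simp: algebra_simps)
  have \<Phi>_deriv: "(\<Phi> has_vector_derivative f x) (at x within {M..R})" if "x \<in> {M..R}" for x
    unfolding \<Phi>_def by (rule integral_has_vector_derivative[OF cont that])
  have cont_\<Phi>: "continuous_on {M..R} \<Phi>"
    using \<Phi>_deriv has_vector_derivative_continuous continuous_on_eq_continuous_within by blast
  have cont_w: "continuous_on {M..R} w" "continuous_on {M..R} w'"
    unfolding w_def w'_def by (intro continuous_intros)+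
  have "((\<lambda>x. \<Phi> x * w' x + f x * w x) has_integral (\<Phi> R * w R - \<Phi> M * w M)) {M..R}"
    by (rule fundamental_theorem_of_calculus[OF M(2)])
      (intro has_vector_derivative_mult \<Phi>_deriv w_deriv)
  moreover have int_\<Phi>w': "(\<lambda>x. \<Phi> x * w' x) integrable_on {M..R}"
    by (intro integrable_continuous_real continuous_intros cont_\<Phi> cont_w)
  ultimately have "((\<lambda>x. (\<Phi> x * w' x + f x * w x) - \<Phi> x * w' x) has_integral
       (\<Phi> R * w R - \<Phi> M * w M) - integral {M..R} (\<lambda>x. \<Phi> x * w' x)) {M..R}"
    by (intro has_integral_diff) (auto intro: integrable_integral)
  then have parts: "integral {M..R} (\<lambda>x. f x * w x) = \<Phi> R * w R - integral {M..R} (\<lambda>x. \<Phi> x * w' x)"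
    by (simp add: integral_unique \<Phi>_def)
  \<comment> \<open>Since \<open>2 x + 1 \<le> 3 x\<close> for \<open>x \<ge> 1\<close>, the derivative of \<open>w\<close> has a majorant with an elementary
     primitive.\<close>
  have major: "((\<lambda>x. \<eta> * (\<epsilon> * (3 * x) * exp (- \<epsilon> * x\<^sup>2))) has_integral
      (- (3/2) * \<eta> * exp (- \<epsilon> * R\<^sup>2) - - (3/2) * \<eta> * exp (- \<epsilon> * M\<^sup>2))) {M..R}"
    by (rule fundamental_theorem_of_calculus[OF M(2)])
      (auto intro!: derivative_eq_intros simp flip: has_real_derivative_iff_has_vector_derivative)
  have bound: "norm (\<Phi> x * w' x) \<le> \<eta> * (\<epsilon> * (3 * x) * exp (- \<epsilon> * x\<^sup>2))" if "x \<in> {M..R}" for x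
  proof -
    have "norm (2 * of_real x + of_real s * \<i> :: complex) \<le> norm (2 * of_real x :: complex) + norm (of_real s * \<i> :: complex)"
      by (rule norm_triangle_ineq)
    also have "\<dots> \<le> 3 * x"
      using that M s by (simp add: norm_mult)
    finally have "norm (w' x) \<le> \<epsilon> * (3 * x) * exp (- \<epsilon> * x\<^sup>2)"
      using eps by (simp add: w'_def norm_mult norm_w)
    then show ?thesis
      using tail[OF that] \<eta> unfolding \<Phi>_def norm_mult by (intro mult_mono) auto
  qed
  have "norm (integral {M..R} (\<lambda>x. \<Phi> x * w' x))
      \<le> - (3/2) * \<eta> * exp (- \<epsilon> * R\<^sup>2) - - (3/2) * \<eta> * exp (- \<epsilon> * M\<^sup>2)"
    using integral_norm_bound_integral[OF int_\<Phi>w' has_integral_integrable[OF major] bound]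
    unfolding integral_unique[OF major] .
  also have "\<dots> \<le> (3/2) * \<eta> * 1"
  proof -
    have "(3/2) * \<eta> * exp (- \<epsilon> * M\<^sup>2) \<le> (3/2) * \<eta> * 1"
      using eps \<eta> by (intro mult_left_mono) auto
    moreover have "0 \<le> (3/2) * \<eta> * exp (- \<epsilon> * R\<^sup>2)"
      using \<eta> by simp
    ultimately show ?thesis by linarith
  qed
  finally have "norm (integral {M..R} (\<lambda>x. \<Phi> x * w' x)) \<le> (3/2) * \<eta>" by simp
  moreover have "norm (\<Phi> R * w R) \<le> \<eta> * 1"
    unfolding norm_mult norm_w \<Phi>_def using tail[of R] M eps \<eta> by (intro mult_mono) auto
  ultimately have "norm (integral {M..R} (\<lambda>x. f x * w x)) \<le> 3 * \<eta>"
    using norm_triangle_ineq4[of "\<Phi> R * w R" "integral {M..R} (\<lambda>x. \<Phi> x * w' x)"] \<eta>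
    by (simp add: parts)
  then show ?thesis unfolding w_def .
qed

text \<open>An Abelian theorem. Convergence of the integral over the whole line makes both tails small separately,
  hence by \<open>gaussian_abel_tail\<close> the weighted tails are small uniformly in \<open>\<epsilon>\<close>; on the remaining compact
  interval the weight tends to \<open>1\<close> uniformly. Smallness of each single tail is what a merely symmetric
  limit would not provide.\<close>

lemma gaussian_abel_summation:
  fixes f :: "real \<Rightarrow> complex" and c v :: complex
  assumes cont: "continuous_on UNIV f" and v: "(f has_integral v) UNIV"
    and weighted: "\<And>\<epsilon>. 0 < \<epsilon> \<Longrightarrow>
      ((\<lambda>R. integral {- R..R} (\<lambda>t. f t * exp (- of_real \<epsilon> * (of_real t * (of_real t + \<i>)))))
         \<longlongrightarrow> c * exp (- of_real \<epsilon> / 4)) at_top"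
  shows "c = v"
proof -
  define w where "w = (\<lambda>\<epsilon> t::real. exp (- of_real \<epsilon> * (of_real t * (of_real t + \<i>))) :: complex)"
  have cont_f: "continuous_on A f" for A
    using cont continuous_on_subset by blast
  have cont_fw: "continuous_on A (\<lambda>t. f t * w \<epsilon> t)" for A \<epsilon>
    unfolding w_def by (intro continuous_intros cont_f)
  have int_f: "f integrable_on {u..s}" and int_fw: "(\<lambda>t. f t * w \<epsilon> t) integrable_on {u..s}" for u s \<epsilon>
    by (intro integrable_continuous_real cont_f cont_fw)+
  \<comment> \<open>The constant counts two weighted tails, each at most \<open>3 (2 \<eta>)\<close>, and one \<open>\<eta>\<close> for cutting off \<open>f\<close>.\<close>
  have close: "norm (c - v) \<le> 13 * \<eta>" if \<eta>: "0 < \<eta>" for \<eta>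
  proof -
    obtain B where B: "0 < B" "\<And>u s. ball 0 B \<subseteq> cbox u s \<Longrightarrow>
        norm (integral (cbox u s) (\<lambda>x. if x \<in> UNIV then f x else 0) - v) < \<eta>"
      using v \<eta> unfolding has_integral_alt' by metis
    have near: "norm (integral {u..s} f - v) \<le> \<eta>" if "u \<le> - B" "B \<le> s" for u s
      using B(2)[of u s] that by (force simp: dist_real_def)
    define M where "M = max 1 B"
    have M: "1 \<le> M" "B \<le> M" by (auto simp: M_def)
    have right: "norm (integral {M..x} f) \<le> 2 * \<eta>" if "M \<le> x" for x
    proof -
      have "integral {- M..M} f + integral {M..x} f = integral {- M..x} f"
        using that M by (intro Henstock_Kurzweil_Integration.integral_combine int_f) auto
      then have "integral {M..x} f = (integral {- M..x} f - v) - (integral {- M..M} f - v)"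
        by (simp add: algebra_simps)
      also have "norm \<dots> \<le> \<eta> + \<eta>"
        using near that M B(1) by (intro order_trans[OF norm_triangle_ineq4] add_mono near) auto
      finally show ?thesis by simp
    qed
    have left: "norm (integral {M..x} (\<lambda>t. f (- t))) \<le> 2 * \<eta>" if "M \<le> x" for x
    proof -
      have "integral {- x..- M} f + integral {- M..M} f = integral {- x..M} f"
        using that M by (intro Henstock_Kurzweil_Integration.integral_combine int_f) auto
      then have "integral {- x..- M} f = (integral {- x..M} f - v) - (integral {- M..M} f - v)"
        by (simp add: algebra_simps)
      also have "norm \<dots> \<le> \<eta> + \<eta>"
        using near that M B(1) by (intro order_trans[OF norm_triangle_ineq4] add_mono near) auto
      finally have "norm (integral {- x..- M} f) \<le> 2 * \<eta>" by simp
      then show ?thesis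
        using Henstock_Kurzweil_Integration.integral_reflect_real[of "- M" "- x" f] by simp
    qed
    have core: "norm (c * exp (- of_real \<epsilon> / 4) - integral {- M..M} (\<lambda>t. f t * w \<epsilon> t)) \<le> 12 * \<eta>"
      if \<epsilon>: "0 < \<epsilon>" for \<epsilon>
    proof (rule tendsto_upperbound)
      show "((\<lambda>R. norm (integral {- R..R} (\<lambda>t. f t * w \<epsilon> t) - integral {- M..M} (\<lambda>t. f t * w \<epsilon> t)))
          \<longlongrightarrow> norm (c * exp (- of_real \<epsilon> / 4) - integral {- M..M} (\<lambda>t. f t * w \<epsilon> t))) at_top"
        unfolding w_def by (intro tendsto_intros weighted \<epsilon>)
      have "norm (integral {- R..R} (\<lambda>t. f t * w \<epsilon> t) - integral {- M..M} (\<lambda>t. f t * w \<epsilon> t)) \<le> 12 * \<eta>"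
        if R: "M \<le> R" for R
      proof -
        have "integral {- R..- M} (\<lambda>t. f t * w \<epsilon> t) + integral {- M..M} (\<lambda>t. f t * w \<epsilon> t)
              = integral {- R..M} (\<lambda>t. f t * w \<epsilon> t)"
             "integral {- R..M} (\<lambda>t. f t * w \<epsilon> t) + integral {M..R} (\<lambda>t. f t * w \<epsilon> t)
              = integral {- R..R} (\<lambda>t. f t * w \<epsilon> t)"
          using R M by (intro Henstock_Kurzweil_Integration.integral_combine int_fw; simp)+
        then have "integral {- R..R} (\<lambda>t. f t * w \<epsilon> t) - integral {- M..M} (\<lambda>t. f t * w \<epsilon> t)
            = integral {- R..- M} (\<lambda>t. f t * w \<epsilon> t) + integral {M..R} (\<lambda>t. f t * w \<epsilon> t)"
          by (simp add: algebra_simps)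
        moreover have "norm (integral {M..R} (\<lambda>t. f t * w \<epsilon> t)) \<le> 3 * (2 * \<eta>)"
          using gaussian_abel_tail[of M R f "2 * \<eta>" \<epsilon> 1] cont_f right M R \<epsilon> by (simp add: w_def)
        moreover have "norm (integral {M..R} (\<lambda>t. f (- t) * w \<epsilon> (- t))) \<le> 3 * (2 * \<eta>)"
        proof -
          have "w \<epsilon> (- t) = exp (- of_real \<epsilon> * (of_real t * (of_real t + of_real (- 1) * \<i>)))" for t
            by (simp add: w_def algebra_simps)
          moreover have "continuous_on {M..R} (\<lambda>t. f (- t))"
            by (intro continuous_on_compose2[OF cont] continuous_intros) auto
          ultimately show ?thesis
            using gaussian_abel_tail[of M R "\<lambda>t. f (- t)" "2 * \<eta>" \<epsilon> "- 1"] left M R \<epsilon> by simp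
        qed
        then have "norm (integral {- R..- M} (\<lambda>t. f t * w \<epsilon> t)) \<le> 3 * (2 * \<eta>)"
          using Henstock_Kurzweil_Integration.integral_reflect_real[of "- M" "- R" "\<lambda>t. f t * w \<epsilon> t"] by simp
        ultimately show ?thesis
          using norm_triangle_ineq[of "integral {- R..- M} (\<lambda>t. f t * w \<epsilon> t)" "integral {M..R} (\<lambda>t. f t * w \<epsilon> t)"]
          by simp
      qed
      then show "eventually (\<lambda>R. norm (integral {- R..R} (\<lambda>t. f t * w \<epsilon> t) - integral {- M..M} (\<lambda>t. f t * w \<epsilon> t)) \<le> 12 * \<eta>) at_top"
        by (rule eventually_at_top_linorderI)
    qed simp
    \<comment> \<open>First \<open>R\<close> went to infinity at fixed \<open>\<epsilon>\<close>; now \<open>\<epsilon>\<close> goes to zero at fixed \<open>M\<close>.\<close>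
    have "continuous_on UNIV (\<lambda>\<epsilon>. integral (cbox (- M) M) (\<lambda>t. f t * w \<epsilon> t))"
      unfolding w_def case_prod_unfold
      by (intro integral_continuous_on_param) (auto simp: case_prod_unfold intro!: continuous_intros continuous_on_compose2[OF cont])
    then have "((\<lambda>\<epsilon>. integral {- M..M} (\<lambda>t. f t * w \<epsilon> t)) \<longlongrightarrow> integral {- M..M} (\<lambda>t. f t * w 0 t)) (at_right 0)"
      by (auto simp: continuous_on_def intro: tendsto_within_subset)
    then have "((\<lambda>\<epsilon>. norm (c * exp (- of_real \<epsilon> / 4) - integral {- M..M} (\<lambda>t. f t * w \<epsilon> t)))
        \<longlongrightarrow> norm (c * exp (- of_real 0 / 4) - integral {- M..M} (\<lambda>t. f t * w 0 t))) (at_right 0)"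
      by (intro tendsto_intros) auto
    then have "norm (c * exp (- of_real 0 / 4) - integral {- M..M} (\<lambda>t. f t * w 0 t)) \<le> 12 * \<eta>"
      by (rule tendsto_upperbound) (use core in \<open>auto intro: eventually_mono[OF eventually_at_right_less]\<close>)
    then have "norm (c - integral {- M..M} f) \<le> 12 * \<eta>"
      by (simp add: w_def)
    then show ?thesis
      using near[of "- M" M] M norm_triangle_ineq[of "c - integral {- M..M} f" "integral {- M..M} f - v"] by simp
  qed
  have "norm (c - v) \<le> e" if "0 < e" for e
    using close[of "e / 13"] that by simp
  then have "norm (c - v) \<le> 0"
    by (rule field_le_epsilon[of _ 0, simplified])
  then show ?thesis by simp
qed

section \<open>The integral formulas\<close>

lemma cosh_integrand_conv_sinh: "cosh_integrand F a x = \<i> * sinh_integrand F a (1 / 2) x"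
proof -
  have half_pi: "\<i> * (of_real pi / 2 * \<i>) = - of_real (pi / 2)"
    by (simp add: complex_eq_iff)
  have "sinh (of_real pi / 2 * \<i>) = \<i>" "cosh (of_real pi / 2 * \<i>) = 0"
    unfolding sinh_conv_sin cosh_conv_cos half_pi sin_minus cos_minus sin_of_real cos_of_real by simp_all
  moreover have "of_real (pi * (1 / 2)) * (2 * of_real x + \<i>) = of_real pi * of_real x + of_real pi / 2 * \<i>"
    by (simp add: algebra_simps)
  ultimately have "sinh (of_real (pi * (1 / 2)) * (2 * of_real x + \<i>)) = \<i> * cosh (of_real pi * of_real x :: complex)"
    by (simp only: sinh_add) simp
  then show ?thesis
    by (simp add: cosh_integrand_def sinh_integrand_def)
qed

theorem mainTheorem3:
  fixes a p :: real and F :: "complex \<Rightarrow> complex"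
  assumes p: "0 < p" "p < 1"
    and analytic: "(\<lambda>x. F (zmap a x)) analytic_on strip"
    and growth: "subexp_growth 1 a F"
  shows "(1 / 2 \<le> p \<or> subexp_growth (2 * p) a F \<longrightarrow>
            has_line_integral (sinh_integrand F a p) (- (\<i> * F (of_real (a / 4)) / of_real (2 * p)))) \<and>
         (1 / 2 < p \<longrightarrow> sinh_integrand F a p absolutely_integrable_on UNIV) \<and>
         (sinh_integrand F a p integrable_on UNIV \<longrightarrow>
            (sinh_integrand F a p has_integral - (\<i> * F (of_real (a / 4)) / of_real (2 * p))) UNIV) \<and>
         has_line_integral (cosh_integrand F a) (F (of_real (a / 4))) \<and>
         (cosh_integrand F a integrable_on UNIV \<longrightarrow>
            (cosh_integrand F a has_integral F (of_real (a / 4))) UNIV)"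
proof -
  have line: "has_line_integral (sinh_integrand F a q) (- (\<i> * F (of_real (a / 4)) / of_real (2 * q)))"
    if "0 < q" "q < 1" "1 / 2 \<le> q \<or> subexp_growth (2 * q) a F" for q
    using that(3) sinh_integrand_line_integral[OF that(1,2) analytic growth]
      sinh_integrand_line_integral[OF that(1,2) analytic, of "2 * q"] that(1) by auto
  \<comment> \<open>For \<open>q < 1 / 2\<close> the growth of \<open>F\<close> does not control the vertical sides of the rectangle, so this
     value does not come from \<open>line\<close>.\<close>
  have full: "(sinh_integrand F a q has_integral - (\<i> * F (of_real (a / 4)) / of_real (2 * q))) UNIV"
    if q: "0 < q" "q < 1" and int: "sinh_integrand F a q integrable_on UNIV" for q
  proof -
    obtain v where v: "(sinh_integrand F a q has_integral v) UNIV"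
      using int by blast
    have "continuous_on UNIV (sinh_integrand F a q)"
      unfolding sinh_integrand_def by (intro continuous_sinh_quotient[OF q analytic])
    then have "- (\<i> * F (of_real (a / 4)) / of_real (2 * q)) = v"
      using v sinh_integral_gaussian_weight[OF q analytic growth]
      by (intro gaussian_abel_summation) auto
    with v show ?thesis by simp
  qed
  have cosh: "cosh_integrand F a = (\<lambda>x. \<i> * sinh_integrand F a (1 / 2) x)"
    using cosh_integrand_conv_sinh by blast
  have sinh: "sinh_integrand F a (1 / 2) = (\<lambda>x. - \<i> * cosh_integrand F a x)"
    by (simp add: cosh)
  have cosh_line: "has_line_integral (cosh_integrand F a) (F (of_real (a / 4)))"
  proof -
    have "has_line_integral (sinh_integrand F a (1 / 2)) (- (\<i> * F (of_real (a / 4))))"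
      using line[of "1 / 2"] by simp
    then have 1: "sinh_integrand F a (1 / 2) integrable_on {- R..R}"
      and 2: "((\<lambda>R. integral {- R..R} (sinh_integrand F a (1 / 2))) \<longlongrightarrow> - (\<i> * F (of_real (a / 4)))) at_top" for R
      by (auto simp: has_line_integral_def)
    have "((\<lambda>R. \<i> * integral {- R..R} (sinh_integrand F a (1 / 2))) \<longlongrightarrow> \<i> * - (\<i> * F (of_real (a / 4)))) at_top"
      by (intro tendsto_intros 2)
    then show ?thesis
      unfolding has_line_integral_def cosh using 1 by (auto intro: integrable_on_mult_right)
  qed
  have cosh_full: "(cosh_integrand F a has_integral F (of_real (a / 4))) UNIV"
    if "cosh_integrand F a integrable_on UNIV"
  proof -
    have "sinh_integrand F a (1 / 2) integrable_on UNIV"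
      unfolding sinh using that by (rule integrable_on_mult_right)
    then have "(sinh_integrand F a (1 / 2) has_integral - (\<i> * F (of_real (a / 4)))) UNIV"
      using full[of "1 / 2"] by simp
    from has_integral_mult_right[OF this, of \<i>] show ?thesis
      by (simp add: cosh)
  qed
  show ?thesis
    using line full sinh_integrand_absolutely_integrable[OF _ p(2) analytic growth] cosh_line cosh_full p
    by blast
qed

end
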